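(* For every integer $n \ge 2$, the upper rank of the semigroup ${\rm End}(B_n)$ satisfies $r_4({\rm End}(B_n)) \ge n+2$.
   Context: For an integer $n \ge 1$ let $[n] = \{1,\ldots,n\}$. The Brandt semigroup $(B_n,+)$ has underlying set $B_n = ([n]\times[n]) \cup \{\vartheta\}$, with operation $(i,j)+(k,l) = (i,l)$ if $j=k$ and $(i,j)+(k,l)=\vartheta$ if $j\neq k$, and $\alpha+\vartheta=\vartheta+\alpha=\vartheta$ for all $\alpha\in B_n$. ${\rm End}(B_n)$ is the semigroup, under composition of mappings, of all semigroup endomorphisms of $(B_n,+)$, i.e. all maps $f: B_n\to B_n$ with $(\alpha+\beta)f = \alpha f+\beta f$; maps are written on the right, so $fg$ means first $f$, then $g$. A subset $U$ of a semigroup $\Gamma$ is independent if $a\notin\langle U\setminus\{a\}\rangle$ for all $a\in U$, where $\langle X\rangle$ is the subsemigroup generated by $X$ (with $\langle\emptyset\rangle=\emptyset$). For a finite semigroup $\Gamma$, the upper rank is $r_4(\Gamma)=\max\{|U| : U\subseteq\Gamma,\ U \text{ is independent}\}$. *)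

theory Defs
  imports Main "HOL-Library.FuncSet"
begin

text \<open>A semigroup is given by a carrier set together with a binary operation on the ambient type.\<close>

text \<open>The generated subsemigroup; there is no unit rule, so the empty set generates the empty set.\<close>

inductive_set subsemigroup_gen :: "('a \<Rightarrow> 'a \<Rightarrow> 'a) \<Rightarrow> 'a set \<Rightarrow> 'a set"
  for f :: "'a \<Rightarrow> 'a \<Rightarrow> 'a" and X :: "'a set" where
  base: "x \<in> X \<Longrightarrow> x \<in> subsemigroup_gen f X"
| mult: "\<lbrakk>x \<in> subsemigroup_gen f X; y \<in> subsemigroup_gen f X\<rbrakk> \<Longrightarrow> f x y \<in> subsemigroup_gen f X"

definition independent_in :: "('a \<Rightarrow> 'a \<Rightarrow> 'a) \<Rightarrow> 'a set \<Rightarrow> bool" where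
  "independent_in f U \<longleftrightarrow> (\<forall>a\<in>U. a \<notin> subsemigroup_gen f (U - {a}))"

text \<open>Meaningful only for finite carriers, since it is a maximum.\<close>

definition upper_rank :: "'a set \<Rightarrow> ('a \<Rightarrow> 'a \<Rightarrow> 'a) \<Rightarrow> nat" where
  "upper_rank S f = Max {card U | U. U \<subseteq> S \<and> independent_in f U}"

text \<open>Endomorphisms of \<open>(A, f)\<close> are extensional functions (\<open>undefined\<close> outside \<open>A\<close>), so that two of
  them are equal in HOL iff they are equal as mappings on \<open>A\<close>.\<close>

definition semigroup_End :: "'a set \<Rightarrow> ('a \<Rightarrow> 'a \<Rightarrow> 'a) \<Rightarrow> ('a \<Rightarrow> 'a) set" where
  "semigroup_End A f = {h \<in> A \<rightarrow>\<^sub>E A. \<forall>x\<in>A. \<forall>y\<in>A. h (f x y) = f (h x) (h y)}"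

text \<open>Maps act on the right: the product of \<open>g\<close> and \<open>h\<close> is first \<open>g\<close>, then \<open>h\<close>.\<close>

definition right_comp :: "'a set \<Rightarrow> ('a \<Rightarrow> 'a) \<Rightarrow> ('a \<Rightarrow> 'a) \<Rightarrow> ('a \<Rightarrow> 'a)" where
  "right_comp A g h = compose A h g"

datatype brandt = Theta | Elt nat nat

fun brandt_add :: "brandt \<Rightarrow> brandt \<Rightarrow> brandt" where
  "brandt_add (Elt i j) (Elt k l) = (if j = k then Elt i l else Theta)"
| "brandt_add Theta b = Theta"
| "brandt_add a Theta = Theta"

definition Brandt :: "nat \<Rightarrow> brandt set" where
  "Brandt n = insert Theta {Elt i j | i j. i \<in> {1..n} \<and> j \<in> {1..n}}"

definition End_Brandt :: "nat \<Rightarrow> (brandt \<Rightarrow> brandt) set" where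
  "End_Brandt n = semigroup_End (Brandt n) brandt_add"

text \<open>The Brandt semigroup and its endomorphism semigroup are semigroups, and the latter is finite,
  so that its upper rank is a genuine maximum.\<close>

lemma brandt_add_closed: "\<lbrakk>a \<in> Brandt n; b \<in> Brandt n\<rbrakk> \<Longrightarrow> brandt_add a b \<in> Brandt n"
  by (cases a; cases b) (simp_all add: Brandt_def)

lemma brandt_add_assoc: "brandt_add (brandt_add a b) c = brandt_add a (brandt_add b c)"
  by (cases a; cases b; cases c) auto

lemma finite_Brandt: "finite (Brandt n)"
proof -
  have "Brandt n = insert Theta ((\<lambda>(i, j). Elt i j) ` ({1..n} \<times> {1..n}))"
    by (auto simp: Brandt_def)
  then show ?thesis by simp
qed

lemma finite_End_Brandt: "finite (End_Brandt n)"
proof (rule finite_subset)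
  show "End_Brandt n \<subseteq> Brandt n \<rightarrow>\<^sub>E Brandt n"
    unfolding End_Brandt_def semigroup_End_def by blast
  show "finite (Brandt n \<rightarrow>\<^sub>E Brandt n)"
    by (rule finite_PiE) (rule finite_Brandt)+
qed

lemma right_comp_closed:
  assumes "g \<in> End_Brandt n" "h \<in> End_Brandt n"
  shows "right_comp (Brandt n) g h \<in> End_Brandt n"
proof -
  have g: "\<And>x. x \<in> Brandt n \<Longrightarrow> g x \<in> Brandt n"
    and h: "\<And>x. x \<in> Brandt n \<Longrightarrow> h x \<in> Brandt n"
    using assms unfolding End_Brandt_def semigroup_End_def by blast+
  have g': "\<And>x y. \<lbrakk>x \<in> Brandt n; y \<in> Brandt n\<rbrakk> \<Longrightarrow> g (brandt_add x y) = brandt_add (g x) (g y)"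
    and h': "\<And>x y. \<lbrakk>x \<in> Brandt n; y \<in> Brandt n\<rbrakk> \<Longrightarrow> h (brandt_add x y) = brandt_add (h x) (h y)"
    using assms unfolding End_Brandt_def semigroup_End_def by blast+
  show ?thesis
    unfolding End_Brandt_def semigroup_End_def right_comp_def compose_def
    by (simp add: PiE_iff g h g' h' brandt_add_closed)
qed

lemma right_comp_assoc:
  assumes "g \<in> End_Brandt n"
  shows "right_comp (Brandt n) (right_comp (Brandt n) g h) k
    = right_comp (Brandt n) g (right_comp (Brandt n) h k)"
proof -
  have "g \<in> Brandt n \<rightarrow> Brandt n"
    using assms unfolding End_Brandt_def semigroup_End_def by blast
  then show ?thesis
    unfolding right_comp_def by (rule compose_assoc)
qed

end

theory Submission
  imports Defs
begin

text \<open>If every product of two elements of a set is one of the two factors, then each subset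
  is closed under products and generates only itself, so the set is independent.
  The endomorphisms of the Brandt semigroup contain such a set with \<open>n + 2\<close> elements.
  An idempotent \<open>e\<close> gives the endomorphism that maps everything to \<open>e\<close>; a
  product of two constant maps is its second factor, and the identity map is neutral for them.
  The idempotents of the Brandt semigroup are \<open>Theta\<close> and the
  \<open>n\<close> pairs \<open>(i, i)\<close>, so there are \<open>n + 1\<close> constant endomorphisms, and the identity
  map is not constant.\<close>

lemma independent_in_if_product_is_factor:
  assumes "\<And>x y. \<lbrakk>x \<in> U; y \<in> U\<rbrakk> \<Longrightarrow> f x y \<in> {x, y}"
  shows "independent_in f U"
proof -
  have "x \<in> V" if "x \<in> subsemigroup_gen f V" "V \<subseteq> U" for x V
    using that
  proof (induction rule: subsemigroup_gen.induct)
    case (mult x y)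
    then have "x \<in> V" "y \<in> V" by simp_all
    moreover from this have "f x y \<in> {x, y}" using assms \<open>V \<subseteq> U\<close> by blast
    ultimately show ?case by (metis insert_iff singletonD)
  qed
  then show ?thesis unfolding independent_in_def by blast
qed

lemma card_le_upper_rank:
  assumes "finite S" "U \<subseteq> S" "independent_in f U"
  shows "card U \<le> upper_rank S f"
proof -
  have "{card U | U. U \<subseteq> S \<and> independent_in f U} \<subseteq> card ` Pow S" by blast
  then have "finite {card U | U. U \<subseteq> S \<and> independent_in f U}"
    using assms(1) finite_subset by blast
  then show ?thesis unfolding upper_rank_def using assms by (intro Max_ge) auto
qed

definition brandt_idempotents :: "nat \<Rightarrow> brandt set" where
  "brandt_idempotents n = insert Theta ((\<lambda>i. Elt i i) ` {1..n})"

lemma brandt_idempotents_subset: "brandt_idempotents n \<subseteq> Brandt n"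
  by (auto simp: brandt_idempotents_def Brandt_def)

lemma brandt_add_idempotent: "e \<in> brandt_idempotents n \<Longrightarrow> brandt_add e e = e"
  by (auto simp: brandt_idempotents_def)

lemma card_brandt_idempotents: "card (brandt_idempotents n) = n + 1"
proof -
  have "inj_on (\<lambda>i. Elt i i) {1..n}" by (simp add: inj_on_def)
  then have "card ((\<lambda>i. Elt i i) ` {1..n}) = n" by (simp add: card_image)
  then show ?thesis unfolding brandt_idempotents_def by (subst card_insert_disjoint) auto
qed

definition const_on_Brandt :: "nat \<Rightarrow> brandt \<Rightarrow> brandt \<Rightarrow> brandt" where
  "const_on_Brandt n e = restrict (\<lambda>_. e) (Brandt n)"

lemma const_on_Brandt_in_End:
  assumes "e \<in> brandt_idempotents n"
  shows "const_on_Brandt n e \<in> End_Brandt n"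
  using assms brandt_idempotents_subset[of n] brandt_add_idempotent[OF assms]
  by (auto simp: End_Brandt_def semigroup_End_def const_on_Brandt_def brandt_add_closed)

lemma id_on_Brandt_in_End: "restrict id (Brandt n) \<in> End_Brandt n"
  by (auto simp: End_Brandt_def semigroup_End_def brandt_add_closed)

lemma inj_const_on_Brandt: "inj (const_on_Brandt n)"
proof (rule injI)
  fix d e assume "const_on_Brandt n d = const_on_Brandt n e"
  then have "const_on_Brandt n d Theta = const_on_Brandt n e Theta" by simp
  then show "d = e" by (simp add: const_on_Brandt_def Brandt_def)
qed

lemma id_on_Brandt_not_const:
  assumes "n \<ge> 1"
  shows "restrict id (Brandt n) \<noteq> const_on_Brandt n e"
proof
  assume eq: "restrict id (Brandt n) = const_on_Brandt n e"
  have "Theta \<in> Brandt n" "Elt 1 1 \<in> Brandt n" using assms by (auto simp: Brandt_def)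
  then have "Theta = e" "Elt 1 1 = e"
    using fun_cong[OF eq, of Theta] fun_cong[OF eq, of "Elt 1 1"]
    by (simp_all add: const_on_Brandt_def)
  then show False by simp
qed

theorem theorem1p9:
  fixes n :: nat
  assumes "n \<ge> 2"
  shows "upper_rank (End_Brandt n) (right_comp (Brandt n)) \<ge> n + 2"
proof -
  let ?C = "const_on_Brandt n ` brandt_idempotents n"
  let ?U = "insert (restrict id (Brandt n)) ?C"
  have "finite ?C" by (simp add: brandt_idempotents_def)
  moreover have "restrict id (Brandt n) \<notin> ?C" using id_on_Brandt_not_const assms by auto
  moreover have "card ?C = n + 1"
    using inj_const_on_Brandt[of n] card_brandt_idempotents
    by (metis card_image inj_on_subset subset_UNIV)
  ultimately have "card ?U = n + 2" by simp
  moreover have "?U \<subseteq> End_Brandt n"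
    using const_on_Brandt_in_End id_on_Brandt_in_End by blast
  moreover have "independent_in (right_comp (Brandt n)) ?U"
  proof (rule independent_in_if_product_is_factor)
    fix g h assume "g \<in> ?U" "h \<in> ?U"
    then show "right_comp (Brandt n) g h \<in> {g, h}"
      using brandt_idempotents_subset[of n]
      by (auto simp: right_comp_def compose_def const_on_Brandt_def fun_eq_iff restrict_def)
  qed
  ultimately show ?thesis
    using card_le_upper_rank[OF finite_End_Brandt] by metis
qed

end
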